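(* Let $W=\{W_t\}_{t\in\mathbb R}$ be a zero-mean Gaussian process with stationary increments and continuous paths, and let $\sigma_t^2=\mathbb E W_t^2=\mathrm{Var}(W_t)$. If $$\lim_{|t|\to\infty}\big(W_t-\sigma_t^2/2\big)=-\infty\quad\text{almost surely},$$ then $$\int_{-\infty}^{\infty}e^{W_t-\sigma_t^2/2}\,dt<\infty\quad\text{almost surely}.$$
   Context: Stationary increments: the law of the process $\{W_{t+h}-W_h\}_{t\in\mathbb R}$ does not depend on $h\in\mathbb R$. *)

theory Defs
  imports "HOL-Probability.Probability"
begin

text \<open>Real Gaussian random variables. Point masses count as Gaussian (variance zero); this matters
  for processes, where for instance \<open>W\<^sub>0 = 0\<close> is allowed. The point-mass case has to be listed
  separately because \<^const>\<open>normal_density\<close> is a density only for a positive standard deviation.\<close>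

definition gaussian_rv :: "'a measure \<Rightarrow> ('a \<Rightarrow> real) \<Rightarrow> bool" where
  "gaussian_rv M X \<longleftrightarrow>
     X \<in> borel_measurable M \<and>
     ((\<exists>\<mu> s. 0 < s \<and> distributed M lborel X (normal_density \<mu> s)) \<or>
      (\<exists>\<mu>. distr M borel X = return borel \<mu>))"

text \<open>A process is Gaussian if its finite-dimensional distributions are (possibly degenerate)
  multivariate normal, i.e. if all finite linear combinations of its values are Gaussian.\<close>

definition gaussian_process :: "'a measure \<Rightarrow> ('t \<Rightarrow> 'a \<Rightarrow> real) \<Rightarrow> bool" where
  "gaussian_process M W \<longleftrightarrow>
     (\<forall>I c. finite I \<longrightarrow> gaussian_rv M (\<lambda>\<omega>. \<Sum>t\<in>I. c t * W t \<omega>))"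

text \<open>The law of a process is its distribution on the product sigma-algebra of the path space.\<close>

definition process_law :: "'a measure \<Rightarrow> ('t \<Rightarrow> 'a \<Rightarrow> real) \<Rightarrow> ('t \<Rightarrow> real) measure" where
  "process_law M W = distr M (\<Pi>\<^sub>M t\<in>UNIV. borel) (\<lambda>\<omega> t. W t \<omega>)"

definition stationary_increments :: "'a measure \<Rightarrow> (real \<Rightarrow> 'a \<Rightarrow> real) \<Rightarrow> bool" where
  "stationary_increments M W \<longleftrightarrow>
     (\<forall>h h'. process_law M (\<lambda>t \<omega>. W (t + h) \<omega> - W h \<omega>) =
             process_law M (\<lambda>t \<omega>. W (t + h') \<omega> - W h' \<omega>))"

end

theory Submission
  imports Defs
begin

text \<open>
  Put \<open>Z t = W t - sigma2 t / 2\<close>, so that \<open>exp (Z t)\<close> has expectation \<open>1\<close> for every \<open>t\<close>. The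
  proof is a mass transport argument.

  The key fact is an invariance: reweighting the probability by \<open>exp (Z h)\<close> turns the law of
  the path \<open>Z\<close>, up to an additive constant, into the law of \<open>Y (t - h)\<close>, where
  \<open>Y t = W t - W 0 - Var(W t - W 0) / 2\<close> does not depend on \<open>h\<close> (\<open>tilted_increment_law\<close>). It
  combines the Cameron-Martin theorem with the stationarity of the increments.

  Now let \<open>E s\<close> be the event that the restriction of \<open>Z\<close> to the integers attains its maximum,
  and does so first at the integer \<open>s\<close>. By the invariance, \<open>exp (Z h)\<close> has integral
  \<open>P(Y (\<cdot> - h) has its first maximum at s)\<close> over \<open>E s\<close>. For the points
  \<open>h = u + k\<close> with \<open>k\<close> an integer this is the probability that \<open>Y (\<cdot> - u)\<close> has its first maximum
  at \<open>s - k\<close>; these events are disjoint, so their probabilities sum up to at most \<open>1\<close>.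
  Integrating over \<open>u\<close> in the unit interval, the expectation of \<open>\<integral> exp (Z t) dt\<close> over
  \<open>E s\<close> is at most \<open>1\<close>. Hence the integral is finite almost surely on each \<open>E s\<close>. Since
  \<open>Z\<close> tends to \<open>-\<infinity>\<close> almost surely, the countably many events \<open>E s\<close> cover almost everything.

  The Cameron-Martin theorem is proved with characteristic functions. That these determine the law
  of a process (\<open>process_law_eqI_iexp\<close>) follows from Levy's one-dimensional uniqueness theorem,
  applied to one coordinate after the other.\<close>

section \<open>Uniqueness theorems for characteristic functions\<close>

text \<open>Levy's uniqueness theorem for finite measures with a density: after division by the total mass,
  which is the value of the transform at \<open>t = 0\<close>, it is the theorem for probability measures.
  The weights are what makes an induction over coordinates possible later on: they carry the
  coordinates that have been dealt with already.\<close>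

lemma distr_density_eqI_iexp:
  fixes X :: "'a \<Rightarrow> real" and Y :: "'b \<Rightarrow> real" and \<phi> :: "'a \<Rightarrow> real" and \<psi> :: "'b \<Rightarrow> real"
  assumes X[measurable]: "X \<in> borel_measurable M" and Y[measurable]: "Y \<in> borel_measurable N"
    and \<phi>: "integrable M \<phi>" "\<And>x. 0 \<le> \<phi> x" and \<psi>: "integrable N \<psi>" "\<And>x. 0 \<le> \<psi> x"
    and eq: "\<And>t. (CLINT \<omega>|M. \<phi> \<omega> * iexp (t * X \<omega>)) = (CLINT \<omega>|N. \<psi> \<omega> * iexp (t * Y \<omega>))"
  shows "distr (density M \<phi>) borel X = distr (density N \<psi>) borel Y"
proof -
  note [measurable] = borel_measurable_integrable[OF \<phi>(1)] borel_measurable_integrable[OF \<psi>(1)]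
  define c where "c = (LINT \<omega>|M. \<phi> \<omega>)"
  have c': "c = (LINT \<omega>|N. \<psi> \<omega>)"
    using eq[of 0] by (simp add: c_def)
  have cM: "(\<integral>\<^sup>+\<omega>. \<phi> \<omega> \<partial>M) = c" and cN: "(\<integral>\<^sup>+\<omega>. \<psi> \<omega> \<partial>N) = c"
    using \<phi> \<psi> by (auto simp: c_def c'[unfolded c_def] nn_integral_eq_integral)
  have em: "emeasure (distr (density M \<phi>) borel X) B = (\<integral>\<^sup>+\<omega>. \<phi> \<omega> * indicator B (X \<omega>) \<partial>M)"
           "emeasure (distr (density N \<psi>) borel Y) B = (\<integral>\<^sup>+\<omega>. \<psi> \<omega> * indicator B (Y \<omega>) \<partial>N)"
    if [measurable]: "B \<in> sets borel" for B
    by (auto simp: emeasure_distr emeasure_density intro!: nn_integral_cong split: split_indicator)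
  have "c \<ge> 0" unfolding c_def using \<phi> by simp
  show ?thesis
  proof (cases "c = 0")
    case True
    have "AE \<omega> in M. \<phi> \<omega> = 0" "AE \<omega> in N. \<psi> \<omega> = 0"
      using cM cN True \<phi> \<psi> by (auto simp: nn_integral_0_iff_AE antisym)
    then have *: "(\<integral>\<^sup>+\<omega>. \<phi> \<omega> * indicator B (X \<omega>) \<partial>M) = 0"
      "(\<integral>\<^sup>+\<omega>. \<psi> \<omega> * indicator B (Y \<omega>) \<partial>N) = 0" if [measurable]: "B \<in> sets borel" for B
      by (subst nn_integral_0_iff_AE; auto)+
    show ?thesis
      by (rule measure_eqI) (simp_all add: em *)
  next
    case False
    with \<open>c \<ge> 0\<close> have c: "c > 0" by simp
    \<comment> \<open>dividing both weights by their common total mass gives probability measures\<close>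
    let ?P = "distr (density M (\<lambda>\<omega>. \<phi> \<omega> / c)) borel X"
    let ?Q = "distr (density N (\<lambda>\<omega>. \<psi> \<omega> / c)) borel Y"
    have "emeasure (density M (\<lambda>\<omega>. \<phi> \<omega> / c)) (space M) = (\<integral>\<^sup>+\<omega>. ennreal (1/c) * \<phi> \<omega> \<partial>M)"
      using c \<phi> by (auto simp: emeasure_density ennreal_mult[symmetric] intro!: nn_integral_cong)
    also have "\<dots> = 1"
      using c by (simp add: nn_integral_cmult cM ennreal_mult[symmetric])
    finally have "prob_space (density M (\<lambda>\<omega>. \<phi> \<omega> / c))"
      by (intro prob_spaceI) simp
    then have P: "real_distribution ?P"
      by (intro prob_space.real_distribution_distr) auto
    have "emeasure (density N (\<lambda>\<omega>. \<psi> \<omega> / c)) (space N) = (\<integral>\<^sup>+\<omega>. ennreal (1/c) * \<psi> \<omega> \<partial>N)"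
      using c \<psi> by (auto simp: emeasure_density ennreal_mult[symmetric] intro!: nn_integral_cong)
    also have "\<dots> = 1"
      using c by (simp add: nn_integral_cmult cN ennreal_mult[symmetric])
    finally have "prob_space (density N (\<lambda>\<omega>. \<psi> \<omega> / c))"
      by (intro prob_spaceI) simp
    then have Q: "real_distribution ?Q"
      by (intro prob_space.real_distribution_distr) auto
    have "char ?P t = char ?Q t" for t
    proof -
      have "char ?P t = (CLINT \<omega>|M. (\<phi> \<omega> * iexp (t * X \<omega>)) / c)"
        unfolding char_def using c \<phi>
        by (subst integral_distr, simp, simp, subst integral_density)
           (auto simp: scaleR_conv_of_real)
      also have "\<dots> = (CLINT \<omega>|N. (\<psi> \<omega> * iexp (t * Y \<omega>)) / c)"
        using eq[of t] by simp
      also have "\<dots> = char ?Q t"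
        unfolding char_def using c \<psi>
        by (subst integral_distr, simp, simp, subst integral_density)
           (auto simp: scaleR_conv_of_real)
      finally show ?thesis .
    qed
    then have PQ: "?P = ?Q" by (intro Levy_uniqueness P Q) auto
    show ?thesis
    proof (rule measure_eqI)
      fix B assume "B \<in> sets (distr (density M \<phi>) borel X)"
      then have B[measurable]: "B \<in> sets borel" by simp
      have "emeasure (distr (density M \<phi>) borel X) B = ennreal c * emeasure ?P B"
        using c \<phi>
        by (auto simp: em emeasure_distr emeasure_density nn_integral_cmult[symmetric] ennreal_mult[symmetric]
           intro!: nn_integral_cong split: split_indicator)
      also have "\<dots> = ennreal c * emeasure ?Q B" by (simp add: PQ)
      also have "\<dots> = emeasure (distr (density N \<psi>) borel Y) B"
        using c \<psi>
        by (auto simp: em emeasure_distr emeasure_density nn_integral_cmult[symmetric] ennreal_mult[symmetric]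
           intro!: nn_integral_cong split: split_indicator)
      finally show "emeasure (distr (density M \<phi>) borel X) B = emeasure (distr (density N \<psi>) borel Y) B" .
    qed simp
  qed
qed

lemma integral_weight_eqI_iexp:
  fixes X :: "'a \<Rightarrow> real" and Y :: "'b \<Rightarrow> real" and \<phi> :: "'a \<Rightarrow> real" and \<psi> :: "'b \<Rightarrow> real"
    and f :: "real \<Rightarrow> complex"
  assumes X[measurable]: "X \<in> borel_measurable M" and Y[measurable]: "Y \<in> borel_measurable N"
    and \<phi>: "integrable M \<phi>" "\<And>x. 0 \<le> \<phi> x" and \<psi>: "integrable N \<psi>" "\<And>x. 0 \<le> \<psi> x"
    and eq: "\<And>t. (CLINT \<omega>|M. \<phi> \<omega> * iexp (t * X \<omega>)) = (CLINT \<omega>|N. \<psi> \<omega> * iexp (t * Y \<omega>))"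
    and f[measurable]: "f \<in> borel_measurable borel"
  shows "(CLINT \<omega>|M. \<phi> \<omega> * f (X \<omega>)) = (CLINT \<omega>|N. \<psi> \<omega> * f (Y \<omega>))"
proof -
  note [measurable] = borel_measurable_integrable[OF \<phi>(1)] borel_measurable_integrable[OF \<psi>(1)]
  have "(CLINT \<omega>|M. \<phi> \<omega> * f (X \<omega>)) = (CLINT x|distr (density M \<phi>) borel X. f x)"
    using \<phi> by (subst integral_distr, simp, simp, subst integral_density) (auto simp: scaleR_conv_of_real)
  also have "\<dots> = (CLINT x|distr (density N \<psi>) borel Y. f x)"
    using distr_density_eqI_iexp[OF X Y \<phi> \<psi> eq] by simp
  also have "\<dots> = (CLINT \<omega>|N. \<psi> \<omega> * f (Y \<omega>))"
    using \<psi> by (subst integral_distr, simp, simp, subst integral_density) (auto simp: scaleR_conv_of_real)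
  finally show ?thesis .
qed

lemma integrable_bounded_mult:
  fixes g f :: "'a \<Rightarrow> complex"
  assumes "integrable M f" "g \<in> borel_measurable M" "\<And>x. norm (g x) \<le> C"
  shows "integrable M (\<lambda>x. g x * f x)"
proof (rule Bochner_Integration.integrable_bound[of _ "\<lambda>x. C * norm (f x)"])
  show "AE x in M. norm (g x * f x) \<le> norm (C * norm (f x))"
  proof (intro AE_I2)
    fix x
    have "C \<ge> 0" using assms(3)[of x] norm_ge_zero order_trans by blast
    then show "norm (g x * f x) \<le> norm (C * norm (f x))"
      using assms(3)[of x] by (simp add: norm_mult mult_right_mono)
  qed
qed (use assms in auto)

text \<open>From here on the weight may be the complex number \<open>iexp S\<close>. The uniqueness theorem wants
  nonnegative weights; \<open>1 + cos (S - \<theta>)\<close> is one, and its transform is a combination of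
  the transforms for \<open>iexp (d * S)\<close> with \<open>d = -1, 0, 1\<close>. The angles \<open>\<theta> = 0\<close> and
  \<open>\<theta> = pi / 2\<close> recover the real and the imaginary part of \<open>iexp S\<close>.\<close>

lemma integral_mult_iexp_eqI:
  fixes X S g :: "'a \<Rightarrow> real" and Y T h :: "'b \<Rightarrow> real" and f :: "real \<Rightarrow> complex"
  assumes M: "prob_space M" "prob_space N"
    and [measurable]: "X \<in> borel_measurable M" "S \<in> borel_measurable M" "g \<in> borel_measurable M"
    and [measurable]: "Y \<in> borel_measurable N" "T \<in> borel_measurable N" "h \<in> borel_measurable N"
    and g: "\<And>x. 0 \<le> g x" "\<And>x. g x \<le> 1" and h: "\<And>x. 0 \<le> h x" "\<And>x. h x \<le> 1"
    and eq: "\<And>d t. (CLINT \<omega>|M. g \<omega> * iexp (d * S \<omega> + t * X \<omega>))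
                 = (CLINT \<omega>|N. h \<omega> * iexp (d * T \<omega> + t * Y \<omega>))"
    and f[measurable]: "f \<in> borel_measurable borel"
    and int: "integrable M (\<lambda>\<omega>. f (X \<omega>))" "integrable N (\<lambda>\<omega>. f (Y \<omega>))"
  shows "(CLINT \<omega>|M. g \<omega> * f (X \<omega>) * iexp (S \<omega>)) = (CLINT \<omega>|N. h \<omega> * f (Y \<omega>) * iexp (T \<omega>))"
proof -
  interpret M: prob_space M by fact
  interpret N: prob_space N by fact
  have I1: "integrable M (\<lambda>\<omega>. complex_of_real (g \<omega>) * iexp (d * S \<omega> + t * X \<omega>))" for d t
    using g by (intro M.integrable_const_bound[of _ 1]) (auto simp: norm_mult)
  have I2: "integrable N (\<lambda>\<omega>. complex_of_real (h \<omega>) * iexp (d * T \<omega> + t * Y \<omega>))" for d t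
    using h by (intro N.integrable_const_bound[of _ 1]) (auto simp: norm_mult)
  have e0: "(CLINT \<omega>|M. g \<omega> * f (X \<omega>)) = (CLINT \<omega>|N. h \<omega> * f (Y \<omega>))"
  proof (rule integral_weight_eqI_iexp)
    show "integrable M g" using g by (intro M.integrable_const_bound[of _ 1]) auto
    show "integrable N h" using h by (intro N.integrable_const_bound[of _ 1]) auto
    show "(CLINT \<omega>|M. g \<omega> * iexp (t * X \<omega>)) = (CLINT \<omega>|N. h \<omega> * iexp (t * Y \<omega>))" for t
      using eq[of 0 t] by simp
  qed (use g h in auto)
  have bd: "0 \<le> w * (1 + cos z)" "norm (w * (1 + cos z)) \<le> 2" if "0 \<le> w" "w \<le> 1" for w z :: real
  proof -
    have "0 \<le> 1 + cos z" "1 + cos z \<le> 2"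
      using cos_ge_minus_one[of z] cos_le_one[of z] by linarith+
    then show "0 \<le> w * (1 + cos z)" "norm (w * (1 + cos z)) \<le> 2"
      using that mult_mono[of w 1 "1 + cos z" 2] by simp_all
  qed
  have ec: "(CLINT \<omega>|M. (g \<omega> * (1 + cos (S \<omega> - \<theta>)) :: real) * f (X \<omega>))
          = (CLINT \<omega>|N. (h \<omega> * (1 + cos (T \<omega> - \<theta>)) :: real) * f (Y \<omega>))" for \<theta>
  proof (rule integral_weight_eqI_iexp)
    have c: "complex_of_real (cos z) = (iexp z + iexp (- z)) / 2" for z
      by (simp add: cos_of_real[symmetric] cos_exp_eq)
    \<comment> \<open>the factors 0, 1 and -1 stay unsimplified: they are the instances of \<open>d\<close> in the hypothesis\<close>
    have *: "complex_of_real (w * (1 + cos (s - \<theta>))) * iexp y = w * iexp (0 * s + y)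
        + (w * iexp (1 * s + y) * iexp (-\<theta>) + w * iexp ((-1) * s + y) * iexp \<theta>) / 2" for w s y :: real
      unfolding of_real_mult of_real_add c
      by (simp add: algebra_simps exp_add[symmetric] add_divide_distrib)
    show "(CLINT \<omega>|M. (g \<omega> * (1 + cos (S \<omega> - \<theta>)) :: real) * iexp (t * X \<omega>))
        = (CLINT \<omega>|N. (h \<omega> * (1 + cos (T \<omega> - \<theta>)) :: real) * iexp (t * Y \<omega>))" for t
      unfolding *
      apply (subst (1 2) Bochner_Integration.integral_add)
      apply (intro I1 I2 integrable_divide_zero integrable_mult_left Bochner_Integration.integrable_add impI)+
      apply (subst (1 2) integral_divide_zero)
      apply (subst (1 2) Bochner_Integration.integral_add)
      apply (intro I1 I2 integrable_divide_zero integrable_mult_left Bochner_Integration.integrable_add impI)+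
      apply (simp only: integral_mult_left_zero eq)
      done
    show "integrable M (\<lambda>\<omega>. g \<omega> * (1 + cos (S \<omega> - \<theta>)))"
      by (intro M.integrable_const_bound[of _ 2] AE_I2 bd g) measurable
    show "integrable N (\<lambda>\<omega>. h \<omega> * (1 + cos (T \<omega> - \<theta>)))"
      by (intro N.integrable_const_bound[of _ 2] AE_I2 bd h) measurable
  qed (auto intro!: bd g h)
  have J1: "integrable M (\<lambda>\<omega>. (g \<omega> * u (S \<omega>)) * f (X \<omega>))"
    if [measurable]: "u \<in> borel_measurable borel" and "\<And>s. norm (u s) \<le> 1" for u :: "real \<Rightarrow> complex"
    using that g by (intro integrable_bounded_mult[OF int(1), of _ 1]) (auto simp: norm_mult mult_le_one)
  have J2: "integrable N (\<lambda>\<omega>. (h \<omega> * u (T \<omega>)) * f (Y \<omega>))"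
    if [measurable]: "u \<in> borel_measurable borel" and "\<And>s. norm (u s) \<le> 1" for u :: "real \<Rightarrow> complex"
    using that h by (intro integrable_bounded_mult[OF int(2), of _ 1]) (auto simp: norm_mult mult_le_one)
  have et: "(CLINT \<omega>|M. (complex_of_real (g \<omega>) * complex_of_real (cos (S \<omega> - \<theta>))) * f (X \<omega>))
          = (CLINT \<omega>|N. (complex_of_real (h \<omega>) * complex_of_real (cos (T \<omega> - \<theta>))) * f (Y \<omega>))" for \<theta>
  proof -
    have *: "complex_of_real (w * (1 + cos z)) * y = (complex_of_real w * 1) * y + (complex_of_real w * complex_of_real (cos z)) * y" for w z y
      by (simp add: algebra_simps)
    show ?thesis
      using ec[of \<theta>] e0 J1[of "\<lambda>_. 1"] J2[of "\<lambda>_. 1"]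
        J1[of "\<lambda>s. of_real (cos (s - \<theta>))"] J2[of "\<lambda>s. of_real (cos (s - \<theta>))"]
      unfolding * by simp
  qed
  \<comment> \<open>\<open>s - 0\<close> matches the shape of the previous fact at \<open>\<theta> = 0\<close>\<close>
  have *: "complex_of_real w * y * iexp s = (complex_of_real w * complex_of_real (cos (s - 0))) * y + \<i> * ((complex_of_real w * complex_of_real (cos (s - pi/2))) * y)"
    for w s :: real and y :: complex
  proof -
    have "cos (s - pi/2) = sin s" by (simp add: cos_diff)
    moreover have "iexp s = of_real (cos s) + \<i> * of_real (sin s)"
      by (simp add: exp_Euler cos_of_real sin_of_real)
    ultimately show ?thesis by (simp add: algebra_simps)
  qed
  show ?thesis
    unfolding *
    apply (subst (1 2) Bochner_Integration.integral_add)
    apply (intro J1 J2 integrable_mult_right; simp)+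
    apply (simp only: integral_mult_right_zero et)
    done
qed

lemma measurable_process [measurable (raw)]:
  "(\<And>t. X t \<in> borel_measurable M) \<Longrightarrow> (\<lambda>\<omega> t. X t \<omega>) \<in> M \<rightarrow>\<^sub>M (\<Pi>\<^sub>M t\<in>UNIV. borel)"
  by (intro measurable_PiM_single') (auto simp: PiE_UNIV_domain)

lemma emeasure_process_law_box:
  fixes X :: "'t \<Rightarrow> 'a \<Rightarrow> real" and A :: "'t \<Rightarrow> real set"
  assumes M: "prob_space M" and [measurable]: "\<And>t. X t \<in> borel_measurable M"
    and J: "finite J" and A[measurable]: "\<And>j. j \<in> J \<Longrightarrow> A j \<in> sets borel"
  shows "emeasure (process_law M X) (prod_emb UNIV (\<lambda>_. borel) J (Pi\<^sub>E J A))
       = ennreal (LINT \<omega>|M. (\<Prod>k\<in>J. indicator (A k) (X k \<omega>)))"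
proof -
  interpret prob_space M by fact
  let ?E = "{\<omega>\<in>space M. \<forall>j\<in>J. X j \<omega> \<in> A j}"
  have box: "prod_emb UNIV (\<lambda>_. borel) J (Pi\<^sub>E J A) \<in> sets (\<Pi>\<^sub>M t\<in>UNIV. borel)"
    using J A by (intro sets_PiM_I) auto
  have meas: "(\<lambda>\<omega> t. X t \<omega>) \<in> M \<rightarrow>\<^sub>M (\<Pi>\<^sub>M t\<in>UNIV. borel)"
    by measurable
  have E: "?E \<in> sets M"
    using J by measurable
  have "emeasure (process_law M X) (prod_emb UNIV (\<lambda>_. borel) J (Pi\<^sub>E J A)) = emeasure M ?E"
    unfolding process_law_def emeasure_distr[OF meas box]
    by (intro arg_cong[where f = "emeasure M"]) (auto simp: prod_emb_def PiE_UNIV_domain space_PiM PiE_iff)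
  also have "\<dots> = ennreal (LINT \<omega>|M. indicator ?E \<omega>)"
    using E by (simp add: emeasure_eq_measure Int_absorb2[OF sets.sets_into_space])
  also have "(LINT \<omega>|M. indicator ?E \<omega>) = (LINT \<omega>|M. (\<Prod>k\<in>J. indicator (A k) (X k \<omega>) :: real))"
  proof (rule Bochner_Integration.integral_cong[OF refl])
    fix \<omega> assume "\<omega> \<in> space M"
    show "indicator ?E \<omega> = (\<Prod>k\<in>J. indicator (A k) (X k \<omega>) :: real)"
    proof (cases "\<forall>j\<in>J. X j \<omega> \<in> A j")
      case True then show ?thesis using \<open>\<omega> \<in> space M\<close> by simp
    next
      case False
      then have "(\<Prod>k\<in>J. indicator (A k) (X k \<omega>) :: real) = 0" using J by (intro prod_zero) (auto simp: indicator_eq_0_iff)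
      with False show ?thesis by simp
    qed
  qed
  finally show ?thesis .
qed

text \<open>The law of a process is determined by the characteristic functions of its finite linear
  combinations. The exponentials \<open>iexp (c t * X t)\<close> are replaced by indicators of
  \<open>X t \<in> B t\<close> one coordinate at a time, each time by one-dimensional uniqueness with the
  remaining factors as a weight; at the end only the probability of a box is left.\<close>

theorem process_law_eqI_iexp:
  fixes X :: "'t \<Rightarrow> 'a \<Rightarrow> real" and Y :: "'t \<Rightarrow> 'b \<Rightarrow> real"
  assumes M: "prob_space M" "prob_space N"
    and X[measurable]: "\<And>t. X t \<in> borel_measurable M" and Y[measurable]: "\<And>t. Y t \<in> borel_measurable N"
    and eq: "\<And>J c. finite J \<Longrightarrow> (CLINT \<omega>|M. iexp (\<Sum>t\<in>J. c t * X t \<omega>)) = (CLINT \<omega>|N. iexp (\<Sum>t\<in>J. c t * Y t \<omega>))"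
  shows "process_law M X = process_law N Y"
proof -
  interpret M: prob_space M by fact
  interpret N: prob_space N by fact
  \<comment> \<open>\<open>K\<close> holds the coordinates already converted; \<open>J\<close> may overlap with it\<close>
  have mixed: "(CLINT \<omega>|M. (\<Prod>k\<in>K. indicator (B k) (X k \<omega>) :: real) * iexp (\<Sum>j\<in>J. c j * X j \<omega>))
     = (CLINT \<omega>|N. (\<Prod>k\<in>K. indicator (B k) (Y k \<omega>) :: real) * iexp (\<Sum>j\<in>J. c j * Y j \<omega>))"
    if "finite K" "finite J" "\<And>k. k \<in> K \<Longrightarrow> B k \<in> sets borel" for K J c and B :: "'t \<Rightarrow> real set"
    using that
  proof (induction K arbitrary: J c)
    case empty
    then show ?case using eq by simp
  next
    case (insert k K)
    note [measurable] = insert.prems(2)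
    have comb: "d * (\<Sum>j\<in>J. c j * x j) + t * x k
        = (\<Sum>j\<in>insert k J. (d * (if j \<in> J then c j else 0) + (if j = k then t else 0)) * x j)"
      for d t :: real and x :: "'t \<Rightarrow> real"
    proof -
      have "(\<Sum>j\<in>insert k J. (d * (if j \<in> J then c j else 0) + (if j = k then t else 0)) * x j)
         = (\<Sum>j\<in>insert k J. if j \<in> J then d * (c j * x j) else 0) + (\<Sum>j\<in>insert k J. if j = k then t * x j else 0)"
        unfolding sum.distrib[symmetric] by (intro sum.cong) (auto simp: algebra_simps)
      also have "(\<Sum>j\<in>insert k J. if j \<in> J then d * (c j * x j) else 0) = d * (\<Sum>j\<in>J. c j * x j)"
        using insert.prems(1) by (subst sum.inter_filter[symmetric]) (auto simp: sum_distrib_left intro!: sum.cong)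
      also have "(\<Sum>j\<in>insert k J. if j = k then t * x j else 0) = t * x k"
        using insert.prems(1) by simp
      finally show ?thesis ..
    qed
    have "(CLINT \<omega>|M. complex_of_real (\<Prod>k\<in>K. indicator (B k) (X k \<omega>)) * indicator (B k) (X k \<omega>) * iexp (\<Sum>j\<in>J. c j * X j \<omega>))
     = (CLINT \<omega>|N. complex_of_real (\<Prod>k\<in>K. indicator (B k) (Y k \<omega>)) * indicator (B k) (Y k \<omega>) * iexp (\<Sum>j\<in>J. c j * Y j \<omega>))"
    proof (rule integral_mult_iexp_eqI[OF M])
      show "integrable M (\<lambda>\<omega>. indicator (B k) (X k \<omega>) :: complex)"
        by (rule M.integrable_const_bound[of _ 1]) (auto simp: indicator_def)
      show "integrable N (\<lambda>\<omega>. indicator (B k) (Y k \<omega>) :: complex)"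
        by (rule N.integrable_const_bound[of _ 1]) (auto simp: indicator_def)
      show "(CLINT \<omega>|M. (\<Prod>k\<in>K. indicator (B k) (X k \<omega>) :: real) * iexp (d * (\<Sum>j\<in>J. c j * X j \<omega>) + t * X k \<omega>))
         = (CLINT \<omega>|N. (\<Prod>k\<in>K. indicator (B k) (Y k \<omega>) :: real) * iexp (d * (\<Sum>j\<in>J. c j * Y j \<omega>) + t * Y k \<omega>))" for d t
        unfolding comb[of d "\<lambda>j. X j \<omega>" t for \<omega>] comb[of d "\<lambda>j. Y j \<omega>" t for \<omega>]
        using insert.prems by (intro insert.IH) auto
    qed (use insert.prems in \<open>auto intro!: prod_nonneg prod_le_1 borel_measurable_prod\<close>)
    moreover have "complex_of_real (indicator A x) = indicator A x" for A and x :: real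
      by (simp add: indicator_def)
    ultimately show ?case
      by (simp only: prod.insert[OF insert.hyps] of_real_mult mult_ac)
  qed
  show ?thesis
  proof (rule measure_eqI_PiM_infinite)
    fix A :: "'t \<Rightarrow> real set" and J :: "'t set"
    assume J: "finite J" "\<And>i. i \<in> J \<Longrightarrow> A i \<in> sets borel"
    have "complex_of_real (LINT \<omega>|M. (\<Prod>k\<in>J. indicator (A k) (X k \<omega>))) = complex_of_real (LINT \<omega>|N. (\<Prod>k\<in>J. indicator (A k) (Y k \<omega>)))"
      using mixed[OF J(1) _ J(2), of "{}"] by (simp del: of_real_prod)
    then show "emeasure (process_law M X) (prod_emb UNIV (\<lambda>_. borel) J (Pi\<^sub>E J A))
      = emeasure (process_law N Y) (prod_emb UNIV (\<lambda>_. borel) J (Pi\<^sub>E J A))"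
      using J by (simp add: emeasure_process_law_box M X Y)
  next
    show "finite_measure (process_law M X)"
      unfolding process_law_def
      by (intro M.finite_measure_distr) measurable
  qed (simp_all add: process_law_def)
qed

lemma integral_pair_mult:
  fixes a b :: "_ \<Rightarrow> complex"
  assumes "prob_space M" "integrable M a" "integrable M b"
  shows "(CLINT p|M \<Otimes>\<^sub>M M. a (fst p) * b (snd p)) = (CLINT x|M. a x) * (CLINT x|M. b x)"
    and "integrable (M \<Otimes>\<^sub>M M) (\<lambda>p. a (fst p) * b (snd p))"
proof -
  interpret prob_space M by fact
  interpret pair_sigma_finite M M ..
  note [measurable] = borel_measurable_integrable[OF assms(2)] borel_measurable_integrable[OF assms(3)]
  show I: "integrable (M \<Otimes>\<^sub>M M) (\<lambda>p. a (fst p) * b (snd p))"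
    using assms by (intro Fubini_integrable) (auto simp: norm_mult)
  show "(CLINT p|M \<Otimes>\<^sub>M M. a (fst p) * b (snd p)) = (CLINT x|M. a x) * (CLINT x|M. b x)"
    by (subst integral_fst'[OF I, symmetric]) simp
qed

text \<open>If the joint characteristic function of \<open>X\<close> and \<open>Z\<close> factorizes, then
  \<open>X\<close> and \<open>Z\<close> behave like independent variables. This is uniqueness once more, comparing
  \<open>(X, Z)\<close> on \<open>M\<close> with an independent copy of it on \<open>M \<Otimes>\<^sub>M M\<close>.\<close>

lemma integral_mult_iexp_of_factorization:
  fixes X Z :: "'a \<Rightarrow> real" and f :: "real \<Rightarrow> complex"
  assumes M: "prob_space M"
    and [measurable]: "X \<in> borel_measurable M" "Z \<in> borel_measurable M" "f \<in> borel_measurable borel"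
    and factor: "\<And>d t. (CLINT \<omega>|M. iexp (d * Z \<omega> + t * X \<omega>)) = (CLINT \<omega>|M. iexp (d * Z \<omega>)) * (CLINT \<omega>|M. iexp (t * X \<omega>))"
    and int: "integrable M (\<lambda>\<omega>. f (X \<omega>))"
  shows "(CLINT \<omega>|M. f (X \<omega>) * iexp (Z \<omega>)) = (CLINT \<omega>|M. f (X \<omega>)) * (CLINT \<omega>|M. iexp (Z \<omega>))"
proof -
  interpret prob_space M by fact
  have i: "integrable M (\<lambda>\<omega>. iexp (d * Y \<omega>))" if [measurable]: "Y \<in> borel_measurable M" for d and Y :: "'a \<Rightarrow> real"
    by (rule integrable_const_bound[of _ 1]) auto
  interpret pair_prob_space M M ..
  have "(CLINT \<omega>|M. (1::real) * f (X \<omega>) * iexp (Z \<omega>))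
      = (CLINT p|M \<Otimes>\<^sub>M M. (1::real) * f (X (fst p)) * iexp (Z (snd p)))"
  proof (rule integral_mult_iexp_eqI[OF M])
    fix d t
    have "(CLINT p|M \<Otimes>\<^sub>M M. iexp (d * Z (snd p) + t * X (fst p)))
      = (CLINT p|M \<Otimes>\<^sub>M M. iexp (t * X (fst p)) * iexp (d * Z (snd p)))"
      by (simp add: exp_add[symmetric] algebra_simps)
    also have "\<dots> = (CLINT \<omega>|M. iexp (t * X \<omega>)) * (CLINT \<omega>|M. iexp (d * Z \<omega>))"
      by (intro integral_pair_mult(1) M i) auto
    also have "\<dots> = (CLINT \<omega>|M. iexp (d * Z \<omega> + t * X \<omega>))"
      by (simp only: factor mult.commute)
    finally show "(CLINT \<omega>|M. (1::real) * iexp (d * Z \<omega> + t * X \<omega>))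
        = (CLINT p|M \<Otimes>\<^sub>M M. (1::real) * iexp (d * Z (snd p) + t * X (fst p)))" by simp
  next
    show "prob_space (M \<Otimes>\<^sub>M M)" by (rule P.prob_space_axioms)
    show "integrable (M \<Otimes>\<^sub>M M) (\<lambda>p. f (X (fst p)))"
      using integral_pair_mult(2)[OF M int, of "\<lambda>_. 1"] by simp
  qed (use int in auto)
  then show ?thesis
    using integral_pair_mult(1)[OF M int i[of Z 1]] by simp
qed

section \<open>Gaussian spaces and the Cameron-Martin theorem\<close>

lemma iexp_normal_density:
  assumes s: "0 < s"
  shows "(CLINT x|lborel. normal_density m s x *\<^sub>R iexp (c * x)) = iexp (c * m) * complex_of_real (exp (- (c * s)\<^sup>2 / 2))"
proof -
  have "(CLINT x|lborel. normal_density m s x *\<^sub>R iexp (c * x))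
      = s *\<^sub>R (CLINT y|lborel. normal_density m s (m + s * y) *\<^sub>R iexp (c * (m + s * y)))"
    using s by (subst lborel_integral_real_affine[of s _ m]) auto
  also have "\<dots> = (CLINT y|lborel. iexp (c * m) * (std_normal_density y *\<^sub>R iexp ((c * s) * y)))"
  proof -
    have "s *\<^sub>R (normal_density m s (m + s * y) *\<^sub>R iexp (c * (m + s * y)))
        = iexp (c * m) * (std_normal_density y *\<^sub>R iexp ((c * s) * y))" for y
    proof -
      have "s * normal_density m s (m + s * y) = std_normal_density y"
        using s by (simp add: normal_density_def power_mult_distrib real_sqrt_mult)
      moreover have "iexp (c * (m + s * y)) = iexp (c * m) * iexp ((c * s) * y)"
        by (simp add: exp_add[symmetric] algebra_simps)
      ultimately show ?thesis by (simp add: scaleR_conv_of_real del: of_real_mult flip: of_real_mult)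
    qed
    then show ?thesis by (simp only: integral_scaleR_right[symmetric])
  qed
  also have "\<dots> = iexp (c * m) * char std_normal_distribution (c * s)"
    unfolding char_def by (subst integral_density) (auto simp flip: integral_mult_right_zero)
  finally show ?thesis
    by (simp add: char_std_normal_distribution)
qed

text \<open>The ambient structure for Gaussian computations: a linear space of variables, all of them
  centered Gaussian. In such a space uncorrelated variables are independent.\<close>

definition centered_gaussian_space :: "'a measure \<Rightarrow> ('a \<Rightarrow> real) set \<Rightarrow> bool" where
  "centered_gaussian_space M H \<longleftrightarrow> prob_space M \<and>
     (\<forall>X\<in>H. gaussian_rv M X \<and> (LINT \<omega>|M. X \<omega>) = 0) \<and>
     (\<forall>X\<in>H. \<forall>Y\<in>H. \<forall>a b. (\<lambda>\<omega>. a * X \<omega> + b * Y \<omega>) \<in> H)"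

lemma centered_gaussian_cases:
  assumes M: "prob_space M" and X: "gaussian_rv M X" "(LINT \<omega>|M. X \<omega>) = 0"
  obtains (normal) s where "0 < s" "distributed M lborel X (normal_density 0 s)" "(LINT \<omega>|M. (X \<omega>)\<^sup>2) = s\<^sup>2"
    | (zero) "AE \<omega> in M. X \<omega> = 0" "(LINT \<omega>|M. (X \<omega>)\<^sup>2) = 0"
proof -
  interpret prob_space M by fact
  have [measurable]: "X \<in> borel_measurable M" using X by (simp add: gaussian_rv_def)
  from X(1) consider m s where "0 < s" "distributed M lborel X (normal_density m s)"
    | m where "distr M borel X = return borel m"
    unfolding gaussian_rv_def by auto
  then show thesis
  proof cases
    case 1
    with X have "m = 0" using normal_distributed_expectation by simp
    with 1 X normal_distributed_variance[of s X m] show ?thesis by (intro normal) auto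
  next
    case 2
    have "AE x in distr M borel X. x = m" unfolding 2 by (simp add: AE_return)
    then have *: "AE \<omega> in M. X \<omega> = m" by (simp add: AE_distr_iff)
    then have "(LINT \<omega>|M. X \<omega>) = (LINT \<omega>|M. m)" by (intro integral_cong_AE) auto
    with X have "m = 0" by (simp add: prob_space)
    with * have **: "AE \<omega> in M. X \<omega> = 0" by simp
    then have "(LINT \<omega>|M. (X \<omega>)\<^sup>2) = (LINT \<omega>|M. 0)" by (intro integral_cong_AE) auto
    with ** show ?thesis by (intro zero) auto
  qed
qed

text \<open>The one-dimensional computation behind the Cameron-Martin theorem is in the last part: weighting by
  \<open>exp (X - v / 2)\<close> moves the mean of \<open>X\<close> from \<open>0\<close> to its variance \<open>v\<close>, which multiplies the
  characteristic function by \<open>iexp (c * v)\<close>.\<close>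

lemma
  fixes X :: "'a \<Rightarrow> real"
  assumes M: "prob_space M" and X: "gaussian_rv M X" "(LINT \<omega>|M. X \<omega>) = 0"
  defines "v \<equiv> (LINT \<omega>|M. (X \<omega>)\<^sup>2)"
  shows integrable_centered_gaussian: "integrable M X"
    and integrable_square_centered_gaussian: "integrable M (\<lambda>\<omega>. (X \<omega>)\<^sup>2)"
    and iexp_centered_gaussian: "(CLINT \<omega>|M. iexp (X \<omega>)) = complex_of_real (exp (- v / 2))"
    and integrable_exp_centered_gaussian: "integrable M (\<lambda>\<omega>. exp (X \<omega> - v / 2))"
    and exp_iexp_centered_gaussian:
      "\<And>c. (CLINT \<omega>|M. complex_of_real (exp (X \<omega> - v / 2)) * iexp (c * X \<omega>)) = complex_of_real (exp (- (c\<^sup>2 * v) / 2)) * iexp (c * v)"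
proof -
  interpret prob_space M by fact
  have X_meas[measurable]: "X \<in> borel_measurable M" using X by (simp add: gaussian_rv_def)
  have *: "integrable M X \<and> integrable M (\<lambda>\<omega>. (X \<omega>)\<^sup>2) \<and> (CLINT \<omega>|M. iexp (X \<omega>)) = complex_of_real (exp (- v / 2))
    \<and> integrable M (\<lambda>\<omega>. exp (X \<omega> - v / 2))
    \<and> (\<forall>c. (CLINT \<omega>|M. complex_of_real (exp (X \<omega> - v / 2)) * iexp (c * X \<omega>)) = complex_of_real (exp (- (c\<^sup>2 * v) / 2)) * iexp (c * v))"
    using M X
  proof (cases rule: centered_gaussian_cases)
    case (normal s)
    note s = normal(1) and D = normal(2)
    have v: "v = s\<^sup>2" using normal(3) by (simp add: v_def)
    have ex: "(CLINT \<omega>|M. f (X \<omega>)) = (CLINT x|lborel. normal_density 0 s x *\<^sub>R f x)"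
      if [measurable]: "f \<in> borel_measurable borel" for f :: "real \<Rightarrow> complex"
    proof -
      have "(CLINT x|lborel. normal_density 0 s x *\<^sub>R f x) = (CLINT x|density lborel (normal_density 0 s). f x)"
        by (subst integral_density) auto
      also have "\<dots> = (CLINT x|distr M lborel X. f x)"
        using distributed_distr_eq_density[OF D] by simp
      also have "\<dots> = (CLINT \<omega>|M. f (X \<omega>))" by (subst integral_distr) auto
      finally show ?thesis ..
    qed
    \<comment> \<open>completing the square: the tilted density is the one with mean \<open>v\<close>\<close>
    have shift: "normal_density 0 s x * exp (x - v / 2) = normal_density v s x" for x
      using s by (simp add: normal_density_def v exp_add[symmetric] power2_eq_square field_simps)
    have i1: "integrable M X"
      using distributed_integrable[OF D, of "\<lambda>x. x"] integrable_normal_moment[OF s, of 0 1] by simp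
    have i2: "integrable M (\<lambda>\<omega>. (X \<omega>)\<^sup>2)"
      using distributed_integrable[OF D, of "\<lambda>x. x\<^sup>2"] integrable_normal_moment[OF s, of 0 2] by simp
    have i3: "integrable M (\<lambda>\<omega>. exp (X \<omega> - v / 2))"
      using distributed_integrable[OF D, of "\<lambda>x. exp (x - v / 2)"] integrable_normal_density[OF s, of v]
      by (simp add: shift)
    have "(CLINT \<omega>|M. iexp (1 * X \<omega>)) = complex_of_real (exp (- v / 2))"
      by (subst ex) (use iexp_normal_density[OF s, of 0 1] in \<open>auto simp: v exp_of_real[symmetric]\<close>)
    moreover have "(CLINT \<omega>|M. complex_of_real (exp (X \<omega> - v / 2)) * iexp (c * X \<omega>)) = complex_of_real (exp (- (c\<^sup>2 * v) / 2)) * iexp (c * v)" for c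
    proof -
      have "(CLINT \<omega>|M. complex_of_real (exp (X \<omega> - v / 2)) * iexp (c * X \<omega>))
        = (CLINT x|lborel. normal_density 0 s x *\<^sub>R (complex_of_real (exp (x - v / 2)) * iexp (c * x)))"
        by (subst ex) auto
      also have "\<dots> = (CLINT x|lborel. (normal_density 0 s x * exp (x - v / 2)) *\<^sub>R iexp (c * x))"
        by (simp add: scaleR_conv_of_real exp_of_real mult_ac)
      also have "\<dots> = complex_of_real (exp (- (c\<^sup>2 * v) / 2)) * iexp (c * v)"
        unfolding shift iexp_normal_density[OF s] by (simp add: v power_mult_distrib)
      finally show ?thesis .
    qed
    ultimately show ?thesis using i1 i2 i3 by simp
  next
    case zero
    have v: "v = 0" using zero by (simp add: v_def)
    have "integrable M X = integrable M (\<lambda>_. 0::real)" using zero by (intro integrable_cong_AE) auto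
    moreover have "integrable M (\<lambda>\<omega>. (X \<omega>)\<^sup>2) = integrable M (\<lambda>_. 0::real)" using zero by (intro integrable_cong_AE) auto
    moreover have "integrable M (\<lambda>\<omega>. exp (X \<omega> - v / 2)) = integrable M (\<lambda>_. 1::real)"
      using zero(1) v by (intro integrable_cong_AE) auto
    moreover have "(CLINT \<omega>|M. iexp (X \<omega>)) = (CLINT \<omega>|M. 1)" using zero(1) by (intro integral_cong_AE) auto
    moreover have "(CLINT \<omega>|M. complex_of_real (exp (X \<omega> - v / 2)) * iexp (c * X \<omega>)) = (CLINT \<omega>|M. 1)" for c
      using zero(1) v by (intro integral_cong_AE) auto
    ultimately show ?thesis by (simp add: v prob_space)
  qed
  then show "integrable M X" "integrable M (\<lambda>\<omega>. (X \<omega>)\<^sup>2)" "(CLINT \<omega>|M. iexp (X \<omega>)) = complex_of_real (exp (- v / 2))"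
    "integrable M (\<lambda>\<omega>. exp (X \<omega> - v / 2))"
    by auto
  show "(CLINT \<omega>|M. complex_of_real (exp (X \<omega> - v / 2)) * iexp (c * X \<omega>))
    = complex_of_real (exp (- (c\<^sup>2 * v) / 2)) * iexp (c * v)" for c
    using * by auto
qed

lemma integrable_mult_of_squares:
  fixes X Y :: "'a \<Rightarrow> real"
  assumes [measurable]: "X \<in> borel_measurable M" "Y \<in> borel_measurable M"
    and "integrable M (\<lambda>\<omega>. (X \<omega>)\<^sup>2)" "integrable M (\<lambda>\<omega>. (Y \<omega>)\<^sup>2)"
  shows "integrable M (\<lambda>\<omega>. X \<omega> * Y \<omega>)"
proof (rule Bochner_Integration.integrable_bound)
  show "integrable M (\<lambda>\<omega>. (X \<omega>)\<^sup>2 + (Y \<omega>)\<^sup>2)" using assms by simp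
  show "AE \<omega> in M. norm (X \<omega> * Y \<omega>) \<le> norm ((X \<omega>)\<^sup>2 + (Y \<omega>)\<^sup>2)"
  proof (rule AE_I2)
    fix \<omega>
    have "0 \<le> (\<bar>X \<omega>\<bar> - \<bar>Y \<omega>\<bar>)\<^sup>2" by simp
    then have "2 * (\<bar>X \<omega>\<bar> * \<bar>Y \<omega>\<bar>) \<le> (X \<omega>)\<^sup>2 + (Y \<omega>)\<^sup>2"
      by (simp add: power2_diff)
    moreover have "0 \<le> \<bar>X \<omega>\<bar> * \<bar>Y \<omega>\<bar>" by simp
    ultimately show "norm (X \<omega> * Y \<omega>) \<le> norm ((X \<omega>)\<^sup>2 + (Y \<omega>)\<^sup>2)"
      unfolding real_norm_def abs_mult by linarith
  qed
qed simp

text \<open>The multivariate version reduces to one dimension by orthogonal projection: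
  \<open>V = Z + c * X\<close> with \<open>Z\<close> uncorrelated with \<open>X\<close>. Then \<open>Z\<close> and \<open>X\<close> are independent,
  the weight acts on \<open>c * X\<close> alone, and it shifts \<open>V\<close> by \<open>c * v = Cov(V, X)\<close>.\<close>

theorem centered_gaussian_tilt:
  assumes H: "centered_gaussian_space M H" and X: "X \<in> H" and V: "V \<in> H"
  shows "(CLINT \<omega>|M. complex_of_real (exp (X \<omega> - (LINT \<omega>|M. (X \<omega>)\<^sup>2) / 2)) * iexp (V \<omega>))
     = complex_of_real (exp (- (LINT \<omega>|M. (V \<omega>)\<^sup>2) / 2)) * iexp (LINT \<omega>|M. V \<omega> * X \<omega>)"
proof -
  define v where "v = (LINT \<omega>|M. (X \<omega>)\<^sup>2)"
  have M: "prob_space M" using H by (simp add: centered_gaussian_space_def)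
  then interpret prob_space M .
  have G: "gaussian_rv M Y" "(LINT \<omega>|M. Y \<omega>) = 0" if "Y \<in> H" for Y
    using H that by (auto simp: centered_gaussian_space_def)
  have lin: "(\<lambda>\<omega>. a * Y \<omega> + b * Z \<omega>) \<in> H" if "Y \<in> H" "Z \<in> H" for a b Y Z
    using H that by (auto simp: centered_gaussian_space_def)
  have meas: "Y \<in> borel_measurable M" if "Y \<in> H" for Y
    using G(1)[OF that] by (simp add: gaussian_rv_def)
  note [measurable] = meas[OF X] meas[OF V]
  have sq: "integrable M (\<lambda>\<omega>. (Y \<omega>)\<^sup>2)" if "Y \<in> H" for Y
    by (rule integrable_square_centered_gaussian[OF M G[OF that]])
  show ?thesis
  proof (cases "v = 0")
    case True
    then have 0: "AE \<omega> in M. X \<omega> = 0"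
      using integral_nonneg_eq_0_iff_AE[OF sq[OF X]] by (simp add: v_def)
    then have "(CLINT \<omega>|M. complex_of_real (exp (X \<omega> - v / 2)) * iexp (V \<omega>)) = (CLINT \<omega>|M. iexp (V \<omega>))"
      using True by (intro integral_cong_AE) auto
    moreover have "(LINT \<omega>|M. V \<omega> * X \<omega>) = (LINT \<omega>|M. 0)"
      using 0 by (intro integral_cong_AE) auto
    ultimately show ?thesis
      using iexp_centered_gaussian[OF M G[OF V]] by (simp add: v_def)
  next
    case False
    define c where "c = (LINT \<omega>|M. V \<omega> * X \<omega>) / v"
    define Z where "Z = (\<lambda>\<omega>. 1 * V \<omega> + (- c) * X \<omega>)"
    have Z: "Z \<in> H" unfolding Z_def by (rule lin[OF V X])
    note [measurable] = meas[OF Z]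
    have prod: "integrable M (\<lambda>\<omega>. Y \<omega> * Y' \<omega>)" if "Y \<in> H" "Y' \<in> H" for Y Y'
      using that by (intro integrable_mult_of_squares meas sq)
    have cross: "(LINT \<omega>|M. Z \<omega> * X \<omega>) = 0"
    proof -
      have "(LINT \<omega>|M. Z \<omega> * X \<omega>) = (LINT \<omega>|M. V \<omega> * X \<omega> - c * (X \<omega> * X \<omega>))"
        by (simp add: Z_def algebra_simps)
      also have "\<dots> = (LINT \<omega>|M. V \<omega> * X \<omega>) - c * v"
        using prod[OF V X] prod[OF X X] by (simp add: v_def power2_eq_square)
      finally show ?thesis using False by (simp add: c_def)
    qed
    have var: "(LINT \<omega>|M. (a * Z \<omega> + b * X \<omega>)\<^sup>2) = a\<^sup>2 * (LINT \<omega>|M. (Z \<omega>)\<^sup>2) + b\<^sup>2 * v" for a b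
    proof -
      have "(LINT \<omega>|M. (a * Z \<omega> + b * X \<omega>)\<^sup>2)
          = (LINT \<omega>|M. a\<^sup>2 * (Z \<omega>)\<^sup>2 + b\<^sup>2 * (X \<omega>)\<^sup>2 + (2 * a * b) * (Z \<omega> * X \<omega>))"
        by (intro Bochner_Integration.integral_cong refl) (simp add: power2_eq_square algebra_simps)
      also have "\<dots> = a\<^sup>2 * (LINT \<omega>|M. (Z \<omega>)\<^sup>2) + b\<^sup>2 * v + (2 * a * b) * (LINT \<omega>|M. Z \<omega> * X \<omega>)"
        using sq[OF Z] sq[OF X] prod[OF Z X] by (simp add: v_def)
      finally show ?thesis by (simp add: cross)
    qed
    have cf: "(CLINT \<omega>|M. iexp (a * Z \<omega> + b * X \<omega>)) = complex_of_real (exp (- (a\<^sup>2 * (LINT \<omega>|M. (Z \<omega>)\<^sup>2) + b\<^sup>2 * v) / 2))" for a b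
      using iexp_centered_gaussian[OF M G[OF lin[OF Z X, of a b]]] by (simp only: var)
    have V_eq: "V \<omega> = 1 * Z \<omega> + c * X \<omega>" for \<omega> by (simp add: Z_def)
    have "(CLINT \<omega>|M. complex_of_real (exp (X \<omega> - v / 2)) * iexp (V \<omega>))
       = (CLINT \<omega>|M. (complex_of_real (exp (X \<omega> - v / 2)) * iexp (c * X \<omega>)) * iexp (Z \<omega>))"
      by (simp add: Z_def exp_add[symmetric] algebra_simps exp_of_real[symmetric])
    also have "\<dots> = (CLINT \<omega>|M. complex_of_real (exp (X \<omega> - v / 2)) * iexp (c * X \<omega>)) * (CLINT \<omega>|M. iexp (Z \<omega>))"
    proof (rule integral_mult_iexp_of_factorization[OF M, where f = "\<lambda>x. complex_of_real (exp (x - v / 2)) * iexp (c * x)"])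
      show "(CLINT \<omega>|M. iexp (d * Z \<omega> + t * X \<omega>)) = (CLINT \<omega>|M. iexp (d * Z \<omega>)) * (CLINT \<omega>|M. iexp (t * X \<omega>))" for d t
        using cf[of d t] cf[of d 0] cf[of 0 t]
        by (simp add: exp_of_real[symmetric] exp_add[symmetric] add_divide_distrib diff_divide_distrib)
      have "integrable M (\<lambda>\<omega>. complex_of_real (exp (X \<omega> - v / 2)))"
        using integrable_exp_centered_gaussian[OF M G[OF X]] by (simp add: v_def del: exp_of_real)
      from integrable_bounded_mult[OF this, of "\<lambda>\<omega>. iexp (c * X \<omega>)" 1]
      show "integrable M (\<lambda>\<omega>. complex_of_real (exp (X \<omega> - v / 2)) * iexp (c * X \<omega>))"
        by (simp add: mult.commute)
    qed auto
    also have "\<dots> = complex_of_real (exp (- (c\<^sup>2 * v) / 2)) * iexp (c * v) * complex_of_real (exp (- (LINT \<omega>|M. (Z \<omega>)\<^sup>2) / 2))"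
      using exp_iexp_centered_gaussian[OF M G[OF X], of c] cf[of 1 0] by (simp add: v_def)
    also have "\<dots> = complex_of_real (exp (- (LINT \<omega>|M. (V \<omega>)\<^sup>2) / 2)) * iexp (LINT \<omega>|M. V \<omega> * X \<omega>)"
      using False var[of 1 c] unfolding V_eq[symmetric]
      by (simp add: c_def exp_of_real[symmetric] exp_add[symmetric] algebra_simps add_divide_distrib diff_divide_distrib)
    finally show ?thesis by (simp add: v_def)
  qed
qed

lemma centered_gaussian_space_linear:
  assumes "centered_gaussian_space M H" "X \<in> H" "Y \<in> H"
  shows "(\<lambda>\<omega>. a * X \<omega> + b * Y \<omega>) \<in> H"
  using assms unfolding centered_gaussian_space_def by simp

lemma centered_gaussian_space_sum:
  assumes H: "centered_gaussian_space M H" and J: "finite J" and F: "\<And>t. F t \<in> H"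
  shows "(\<lambda>\<omega>. \<Sum>t\<in>J. c t * F t \<omega>) \<in> H"
  using J
proof (induction J)
  case empty
  have "(\<lambda>\<omega>. 0 * F t \<omega> + 0 * F t \<omega>) \<in> H" for t
    by (rule centered_gaussian_space_linear[OF H F F])
  then show ?case by simp
next
  case (insert t J)
  have "(\<lambda>\<omega>. c t * F t \<omega> + 1 * (\<Sum>t\<in>J. c t * F t \<omega>)) \<in> H"
    by (rule centered_gaussian_space_linear[OF H F insert.IH])
  then show ?case using insert.hyps by simp
qed

text \<open>Weighting by the normalized exponential of \<open>X\<close> shifts every other variable of the space by its
  covariance with \<open>X\<close> and changes nothing else.\<close>

theorem cameron_martin:
  assumes H: "centered_gaussian_space M H" and X: "X \<in> H" and F: "\<And>t. F t \<in> H"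
  defines "Q \<equiv> density M (\<lambda>\<omega>. exp (X \<omega> - (LINT \<omega>|M. (X \<omega>)\<^sup>2) / 2))"
  shows "process_law Q F = process_law M (\<lambda>t \<omega>. F t \<omega> + (LINT \<omega>|M. F t \<omega> * X \<omega>))"
proof -
  define L where "L \<omega> = exp (X \<omega> - (LINT \<omega>|M. (X \<omega>)\<^sup>2) / 2)" for \<omega>
  have M: "prob_space M" using H by (simp add: centered_gaussian_space_def)
  then interpret prob_space M .
  have G: "gaussian_rv M Y" "(LINT \<omega>|M. Y \<omega>) = 0" if "Y \<in> H" for Y
    using H that by (auto simp: centered_gaussian_space_def)
  have meas: "Y \<in> borel_measurable M" if "Y \<in> H" for Y
    using G(1)[OF that] by (simp add: gaussian_rv_def)
  note [measurable] = meas[OF X] meas[OF F]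
  have [measurable]: "L \<in> borel_measurable M" unfolding L_def by measurable
  have Q: "Q = density M L" by (simp add: Q_def L_def)
  have L0: "L \<omega> \<ge> 0" for \<omega> by (simp add: L_def)
  have int_L: "integrable M L"
    using integrable_exp_centered_gaussian[OF M G[OF X]] by (simp add: L_def[abs_def])
  have "complex_of_real (LINT \<omega>|M. L \<omega>) = 1"
    using exp_iexp_centered_gaussian[OF M G[OF X], of 0] by (simp add: L_def del: exp_of_real)
  then have "(LINT \<omega>|M. L \<omega>) = 1" by (simp only: of_real_eq_1_iff)
  then have "emeasure Q (space Q) = 1"
    using int_L L0 by (simp add: Q emeasure_density nn_integral_eq_integral)
  then have PQ: "prob_space Q" by (rule prob_spaceI)
  show ?thesis
  proof (rule process_law_eqI_iexp[OF PQ M])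
    fix J c assume J: "finite (J :: 'b set)"
    define V where "V = (\<lambda>\<omega>. \<Sum>t\<in>J. c t * F t \<omega>)"
    have V: "V \<in> H" unfolding V_def by (rule centered_gaussian_space_sum[OF H J F])
    note [measurable] = meas[OF V]
    have prod: "integrable M (\<lambda>\<omega>. F t \<omega> * X \<omega>)" for t
      by (intro integrable_mult_of_squares integrable_square_centered_gaussian[OF M G] meas F X)
    have cov: "(LINT \<omega>|M. V \<omega> * X \<omega>) = (\<Sum>t\<in>J. c t * (LINT \<omega>|M. F t \<omega> * X \<omega>))"
      using prod by (simp add: V_def sum_distrib_right mult.assoc)
    have "(CLINT \<omega>|Q. iexp (V \<omega>)) = (CLINT \<omega>|M. complex_of_real (L \<omega>) * iexp (V \<omega>))"
      unfolding Q using L0 by (subst integral_density) (auto simp: scaleR_conv_of_real)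
    also have "\<dots> = complex_of_real (exp (- (LINT \<omega>|M. (V \<omega>)\<^sup>2) / 2)) * iexp (LINT \<omega>|M. V \<omega> * X \<omega>)"
      unfolding L_def by (rule centered_gaussian_tilt[OF H X V])
    also have "\<dots> = (CLINT \<omega>|M. iexp (V \<omega>)) * iexp (LINT \<omega>|M. V \<omega> * X \<omega>)"
      by (simp only: iexp_centered_gaussian[OF M G[OF V]])
    also have "\<dots> = (CLINT \<omega>|M. iexp (V \<omega> + (LINT \<omega>|M. V \<omega> * X \<omega>)))"
      by (simp add: exp_add ring_distribs flip: integral_mult_left_zero)
    finally show "(CLINT \<omega>|Q. iexp (\<Sum>t\<in>J. c t * F t \<omega>))
       = (CLINT \<omega>|M. iexp (\<Sum>t\<in>J. c t * (F t \<omega> + (LINT \<omega>|M. F t \<omega> * X \<omega>))))"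
      unfolding cov by (simp add: V_def sum.distrib distrib_left)
  qed (auto simp: Q)
qed

section \<open>The law of the path seen from a weighted point\<close>

lemma process_law_reindex_shift:
  fixes X :: "'t \<Rightarrow> 'a \<Rightarrow> real" and Y :: "'t \<Rightarrow> 'b \<Rightarrow> real" and a :: "'s \<Rightarrow> real"
  assumes [measurable]: "\<And>t. X t \<in> borel_measurable M" "\<And>t. Y t \<in> borel_measurable N"
    and eq: "process_law M X = process_law N Y"
  shows "process_law M (\<lambda>s \<omega>. X (\<tau> s) \<omega> + a s) = process_law N (\<lambda>s \<omega>. Y (\<tau> s) \<omega> + a s)"
proof -
  let ?\<Phi> = "\<lambda>x s. x (\<tau> s) + a s"
  have [measurable]: "?\<Phi> \<in> (\<Pi>\<^sub>M t\<in>UNIV. borel) \<rightarrow>\<^sub>M (\<Pi>\<^sub>M s\<in>UNIV. borel)"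
    by measurable
  have "process_law M (\<lambda>s \<omega>. X (\<tau> s) \<omega> + a s) = distr (process_law M X) (\<Pi>\<^sub>M s\<in>UNIV. borel) ?\<Phi>"
    unfolding process_law_def by (subst distr_distr) (auto simp: comp_def)
  also have "\<dots> = distr (process_law N Y) (\<Pi>\<^sub>M s\<in>UNIV. borel) ?\<Phi>"
    by (simp only: eq)
  also have "\<dots> = process_law N (\<lambda>s \<omega>. Y (\<tau> s) \<omega> + a s)"
    unfolding process_law_def by (subst distr_distr) (auto simp: comp_def)
  finally show ?thesis .
qed

lemma integral_process_law:
  fixes X :: "'t \<Rightarrow> 'a \<Rightarrow> real" and f :: "real \<Rightarrow> real"
  assumes [measurable]: "\<And>t. X t \<in> borel_measurable M" "f \<in> borel_measurable borel"
  shows "(LINT \<omega>|M. f (X t \<omega>)) = (LINT x|process_law M X. f (x t))"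
  unfolding process_law_def by (subst integral_distr) auto

definition process_span :: "('t \<Rightarrow> 'a \<Rightarrow> real) \<Rightarrow> ('a \<Rightarrow> real) set" where
  "process_span W = {\<lambda>\<omega>. \<Sum>t\<in>I. c t * W t \<omega> | I c. finite I}"

lemma in_process_span: "W t \<in> process_span W"
  unfolding process_span_def mem_Collect_eq
  by (intro exI[of _ "{t}"] exI[of _ "\<lambda>_. 1"]) simp

lemma centered_gaussian_space_span:
  assumes M: "prob_space M" and G: "gaussian_process M W" and E: "\<And>t. (LINT \<omega>|M. W t \<omega>) = 0"
  shows "centered_gaussian_space M (process_span W)"
  unfolding centered_gaussian_space_def
proof (intro conjI ballI allI M)
  have g: "gaussian_rv M X" if "X \<in> process_span W" for X
    using that G unfolding process_span_def gaussian_process_def by auto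
  then show "gaussian_rv M X" if "X \<in> process_span W" for X using that .
  have "integrable M (W t)" for t
    using integrable_centered_gaussian[OF M g[OF in_process_span] E] .
  then show "(LINT \<omega>|M. X \<omega>) = 0" if "X \<in> process_span W" for X
    using that by (auto simp: process_span_def E)
next
  fix X Y a b assume "X \<in> process_span W" "Y \<in> process_span W"
  then obtain I c J d where *: "finite I" "X = (\<lambda>\<omega>. \<Sum>t\<in>I. c t * W t \<omega>)" "finite J" "Y = (\<lambda>\<omega>. \<Sum>t\<in>J. d t * W t \<omega>)"
    unfolding process_span_def by auto
  have "a * (\<Sum>t\<in>I. c t * w t) + b * (\<Sum>t\<in>J. d t * w t)
     = (\<Sum>t\<in>I \<union> J. (a * (if t \<in> I then c t else 0) + b * (if t \<in> J then d t else 0)) * w t)" for w :: "_ \<Rightarrow> real"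
  proof -
    have "(\<Sum>t\<in>I. c t * w t) = (\<Sum>t\<in>I \<union> J. (if t \<in> I then c t else 0) * w t)"
      using * by (intro sum.mono_neutral_cong_left) auto
    moreover have "(\<Sum>t\<in>J. d t * w t) = (\<Sum>t\<in>I \<union> J. (if t \<in> J then d t else 0) * w t)"
      using * by (intro sum.mono_neutral_cong_left) auto
    ultimately show ?thesis
      by (simp add: sum_distrib_left sum.distrib[symmetric] algebra_simps)
  qed
  then have "(\<lambda>\<omega>. a * X \<omega> + b * Y \<omega>)
     = (\<lambda>\<omega>. \<Sum>t\<in>I \<union> J. (a * (if t \<in> I then c t else 0) + b * (if t \<in> J then d t else 0)) * W t \<omega>)"
    by (simp add: *)
  then show "(\<lambda>\<omega>. a * X \<omega> + b * Y \<omega>) \<in> process_span W"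
    unfolding process_span_def mem_Collect_eq using *(1,3) by (metis (no_types) finite_UnI)
qed

text \<open>Put \<open>Z t = W t - sigma2 t / 2\<close>. Seen from a point \<open>h\<close> that is chosen with weight
  \<open>exp (Z h)\<close>, the path of \<open>Z\<close> has a law which depends on \<open>h\<close> through a translation only.
  By the Cameron-Martin theorem the increment \<open>W t - W h\<close> acquires the drift
  \<open>Cov(W t - W h, W h)\<close>; together with the difference of the normalizations this is
  minus half the variance of the increment, which by stationarity depends on \<open>t - h\<close> alone.\<close>

theorem tilted_increment_law:
  fixes W :: "real \<Rightarrow> 'a \<Rightarrow> real"
  assumes M: "prob_space M" and G: "gaussian_process M W" and E: "\<And>t. (LINT \<omega>|M. W t \<omega>) = 0"
    and stat: "stationary_increments M W"
    and s2: "\<And>t. sigma2 t = (LINT \<omega>|M. (W t \<omega>)\<^sup>2)"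
  shows "process_law (density M (\<lambda>\<omega>. exp (W h \<omega> - sigma2 h / 2)))
            (\<lambda>t \<omega>. (W t \<omega> - sigma2 t / 2) - (W h \<omega> - sigma2 h / 2))
       = process_law M (\<lambda>t \<omega>. W (t - h) \<omega> - W 0 \<omega> - (LINT \<omega>|M. (W (t - h) \<omega> - W 0 \<omega>)\<^sup>2) / 2)"
proof -
  let ?Q = "density M (\<lambda>\<omega>. exp (W h \<omega> - sigma2 h / 2))"
  define F where "F t \<omega> = W t \<omega> - W h \<omega>" for t \<omega>
  note H = centered_gaussian_space_span[OF M G E]
  have g: "gaussian_rv M (W t)" for t
    using H in_process_span[of W t] by (auto simp: centered_gaussian_space_def)
  then have [measurable]: "W t \<in> borel_measurable M" for t by (simp add: gaussian_rv_def)
  have sq: "integrable M (\<lambda>\<omega>. (W t \<omega>)\<^sup>2)" for t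
    by (rule integrable_square_centered_gaussian[OF M g E])
  have prod: "integrable M (\<lambda>\<omega>. W t \<omega> * W s \<omega>)" for t s
    by (intro integrable_mult_of_squares sq) auto
  have F_meas[measurable]: "F t \<in> borel_measurable M" for t unfolding F_def by measurable
  have F: "F t \<in> process_span W" for t
  proof -
    have "(\<lambda>\<omega>. 1 * W t \<omega> + (-1) * W h \<omega>) \<in> process_span W"
      by (rule centered_gaussian_space_linear[OF H in_process_span in_process_span])
    then show ?thesis by (simp add: F_def[abs_def])
  qed
  have drift: "(LINT \<omega>|M. F t \<omega> * W h \<omega>) + (- (sigma2 t - sigma2 h) / 2) = - (LINT \<omega>|M. (F t \<omega>)\<^sup>2) / 2" for t
  proof -
    have "(LINT \<omega>|M. F t \<omega> * W h \<omega>) = (LINT \<omega>|M. W t \<omega> * W h \<omega>) - sigma2 h"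
      unfolding s2 F_def left_diff_distrib power2_eq_square by (rule Bochner_Integration.integral_diff[OF prod prod])
    moreover have "(LINT \<omega>|M. (F t \<omega>)\<^sup>2) = (LINT \<omega>|M. (W t \<omega>)\<^sup>2 + (W h \<omega>)\<^sup>2 - 2 * (W t \<omega> * W h \<omega>))"
      by (simp add: F_def power2_diff mult.assoc)
    moreover have "\<dots> = sigma2 t + sigma2 h - 2 * (LINT \<omega>|M. W t \<omega> * W h \<omega>)"
      using sq prod by (simp add: s2)
    ultimately have "(LINT \<omega>|M. (F t \<omega>)\<^sup>2) = sigma2 t + sigma2 h - 2 * ((LINT \<omega>|M. F t \<omega> * W h \<omega>) + sigma2 h)"
      by simp
    then show ?thesis by (simp add: diff_divide_distrib add_divide_distrib)
  qed
  have "process_law M (\<lambda>t \<omega>. W (t + h) \<omega> - W h \<omega>) = process_law M (\<lambda>t \<omega>. W (t + 0) \<omega> - W 0 \<omega>)"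
    using stat unfolding stationary_increments_def by blast
  from process_law_reindex_shift[OF _ _ this, of "\<lambda>t. t - h" "\<lambda>_. 0"]
  have inc: "process_law M F = process_law M (\<lambda>t \<omega>. W (t - h) \<omega> - W 0 \<omega>)"
    by (simp add: F_def[abs_def])
  have var: "(LINT \<omega>|M. (F t \<omega>)\<^sup>2) = (LINT \<omega>|M. (W (t - h) \<omega> - W 0 \<omega>)\<^sup>2)" for t
    using integral_process_law[of F M "\<lambda>x. x\<^sup>2" t]
      integral_process_law[of "\<lambda>t \<omega>. W (t - h) \<omega> - W 0 \<omega>" M "\<lambda>x. x\<^sup>2" t] by (simp add: inc)
  have "process_law ?Q F = process_law M (\<lambda>t \<omega>. F t \<omega> + (LINT \<omega>|M. F t \<omega> * W h \<omega>))"
    using cameron_martin[OF H in_process_span[of W h] F] by (simp add: s2)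
  from process_law_reindex_shift[OF _ _ this, of "\<lambda>t. t" "\<lambda>t. - (sigma2 t - sigma2 h) / 2"]
  have "process_law ?Q (\<lambda>t \<omega>. F t \<omega> + (- (sigma2 t - sigma2 h) / 2))
      = process_law M (\<lambda>t \<omega>. F t \<omega> + (- (LINT \<omega>|M. (F t \<omega>)\<^sup>2) / 2))"
    by (simp only: add.assoc drift) simp
  also have "\<dots> = process_law M (\<lambda>t \<omega>. (W (t - h) \<omega> - W 0 \<omega>) + (- (LINT \<omega>|M. (F t \<omega>)\<^sup>2) / 2))"
    by (rule process_law_reindex_shift[OF _ _ inc, of "\<lambda>t. t"]) auto
  finally show ?thesis
    unfolding var by (simp add: F_def diff_divide_distrib algebra_simps)
qed

section \<open>First maxima\<close>

text \<open>The leftmost maximum point of a sequence serves as its marked point: there is at most one, and it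
  moves along with translations. Taking maxima over the integers instead of the real line keeps this
  a countable condition, and any sequence that tends to \<open>-\<infinity>\<close> at both ends has such a point.\<close>

definition first_max :: "(int \<Rightarrow> real) \<Rightarrow> int \<Rightarrow> bool" where
  "first_max z s \<longleftrightarrow> (\<forall>r. z r \<le> z s) \<and> (\<forall>r<s. z r < z s)"

lemma first_max_unique: "first_max z s \<Longrightarrow> first_max z s' \<Longrightarrow> s = s'"
  unfolding first_max_def by (metis linorder_cases not_le)

lemma first_max_exists:
  assumes "finite {m. z 0 \<le> z m}"
  shows "\<exists>s. first_max z s"
proof -
  define S where "S = {m. z 0 \<le> z m}"
  have S: "finite S" "0 \<in> S" using assms by (auto simp: S_def)
  define T where "T = {m\<in>S. z m = Max (z ` S)}"
  have "Max (z ` S) \<in> z ` S" using S by (intro Max_in) auto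
  then have T: "finite T" "T \<noteq> {}" using S by (auto simp: T_def)
  have le: "z r \<le> Max (z ` S)" for r
  proof -
    have "z r \<le> z 0 \<or> r \<in> S" by (auto simp: S_def)
    with S show ?thesis by (auto intro: order_trans[of _ "z 0"])
  qed
  have "first_max z (Min T)"
    unfolding first_max_def
  proof safe
    have "Min T \<in> T" using T by simp
    then have eq: "z (Min T) = Max (z ` S)" by (simp add: T_def)
    show "z r \<le> z (Min T)" for r using le eq by simp
    show "z r < z (Min T)" if "r < Min T" for r
    proof (rule ccontr)
      assume "\<not> ?thesis"
      with le[of r] eq have "z r = Max (z ` S)" by simp
      moreover from this have "r \<in> S" using le[of 0] by (simp add: S_def)
      ultimately have "r \<in> T" by (simp add: T_def)
      from Min_le[OF T(1) this] that show False by linarith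
    qed
  qed
  then show ?thesis ..
qed

lemma first_max_shift: "first_max (\<lambda>m. z (m - k)) s \<longleftrightarrow> first_max z (s - k)"
  unfolding first_max_def
proof (intro conj_cong)
  show "(\<forall>r. z (r - k) \<le> z (s - k)) \<longleftrightarrow> (\<forall>r. z r \<le> z (s - k))"
    by (metis add_diff_cancel_right')
  show "(\<forall>r<s. z (r - k) < z (s - k)) \<longleftrightarrow> (\<forall>r<s - k. z r < z (s - k))"
  proof safe
    fix r assume *: "\<forall>r<s. z (r - k) < z (s - k)" "r < s - k"
    then show "z r < z (s - k)" using *(1)[rule_format, of "r + k"] by simp
  qed simp
qed

lemma first_max_diff_const: "first_max (\<lambda>m. z m - c) s \<longleftrightarrow> first_max z s"
  by (simp add: first_max_def)

lemma measurable_first_max [measurable]: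
  assumes [measurable]: "\<And>m. (\<lambda>\<omega>. z \<omega> m) \<in> borel_measurable M"
  shows "Measurable.pred M (\<lambda>\<omega>. first_max (z \<omega>) s)"
  unfolding first_max_def by measurable

lemma nn_integral_first_max_translates_le_1:
  "(\<integral>\<^sup>+k. indicator {\<omega>. first_max (z \<omega>) (s - k)} \<omega> \<partial>count_space UNIV) \<le> 1"
proof -
  have "k = k'" if "first_max (z \<omega>) (s - k)" "first_max (z \<omega>) (s - k')" for k k'
    using first_max_unique[OF that] by simp
  then obtain k where "{k. first_max (z \<omega>) (s - k)} \<subseteq> {k}" by blast
  then have "(\<integral>\<^sup>+k. indicator {\<omega>. first_max (z \<omega>) (s - k)} \<omega> \<partial>count_space UNIV)
      \<le> (\<integral>\<^sup>+j. indicator {k} j \<partial>count_space UNIV)"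
    by (intro nn_integral_mono) (auto split: split_indicator)
  then show ?thesis by simp
qed

text \<open>The position of the leftmost maximum does not change when a constant is added to the path, so the
  law of the path relative to its value at \<open>h\<close> is all that matters.\<close>

lemma tilted_first_max:
  fixes W :: "real \<Rightarrow> 'a \<Rightarrow> real" and sigma2 :: "real \<Rightarrow> real"
  assumes M: "prob_space M" and G: "gaussian_process M W" and E: "\<And>t. (LINT \<omega>|M. W t \<omega>) = 0"
    and stat: "stationary_increments M W"
    and s2: "\<And>t. sigma2 t = (LINT \<omega>|M. (W t \<omega>)\<^sup>2)"
  defines "Y \<equiv> \<lambda>t \<omega>. W t \<omega> - W 0 \<omega> - (LINT \<omega>|M. (W t \<omega> - W 0 \<omega>)\<^sup>2) / 2"
  shows "(\<integral>\<^sup>+\<omega>. ennreal (exp (W h \<omega> - sigma2 h / 2)) * indicator {\<omega>. first_max (\<lambda>m. W m \<omega> - sigma2 m / 2) s} \<omega> \<partial>M)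
       = (\<integral>\<^sup>+\<omega>. indicator {\<omega>. first_max (\<lambda>m. Y (m - h) \<omega>) s} \<omega> \<partial>M)"
proof -
  let ?Q = "density M (\<lambda>\<omega>. exp (W h \<omega> - sigma2 h / 2))"
  let ?Z = "\<lambda>t \<omega>. (W t \<omega> - sigma2 t / 2) - (W h \<omega> - sigma2 h / 2)"
  have "gaussian_rv M (W t)" for t
    using centered_gaussian_space_span[OF M G E] in_process_span[of W t]
    by (auto simp: centered_gaussian_space_def)
  then have [measurable]: "W t \<in> borel_measurable M" for t by (simp add: gaussian_rv_def)
  have [measurable]: "Y t \<in> borel_measurable M" for t unfolding Y_def by measurable
  define S where "S = {x. first_max (\<lambda>m. x (real_of_int m)) s}"
  have S[measurable]: "S \<in> sets (\<Pi>\<^sub>M t\<in>UNIV. borel)"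
  proof -
    have "{x\<in>space (\<Pi>\<^sub>M t\<in>UNIV. borel). first_max (\<lambda>m. x (real_of_int m)) s} \<in> sets (\<Pi>\<^sub>M t\<in>UNIV. borel)"
      by measurable
    then show ?thesis by (simp add: S_def space_PiM PiE_UNIV_domain)
  qed
  have law: "(\<integral>\<^sup>+x. indicator S x \<partial>process_law N V) = (\<integral>\<^sup>+\<omega>. indicator {\<omega>. first_max (\<lambda>m. V m \<omega>) s} \<omega> \<partial>N)"
    if [measurable]: "\<And>t. V t \<in> borel_measurable N" for N and V :: "real \<Rightarrow> 'a \<Rightarrow> real"
    unfolding process_law_def
    by (subst nn_integral_distr) (auto simp: S_def indicator_def intro!: nn_integral_cong)
  have "(\<integral>\<^sup>+\<omega>. ennreal (exp (W h \<omega> - sigma2 h / 2)) * indicator {\<omega>. first_max (\<lambda>m. W m \<omega> - sigma2 m / 2) s} \<omega> \<partial>M)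
      = (\<integral>\<^sup>+\<omega>. indicator {\<omega>\<in>space M. first_max (\<lambda>m. W m \<omega> - sigma2 m / 2) s} \<omega> \<partial>?Q)"
    by (subst nn_integral_density) (auto intro!: nn_integral_cong split: split_indicator)
  also have "\<dots> = (\<integral>\<^sup>+\<omega>. indicator {\<omega>. first_max (\<lambda>m. ?Z m \<omega>) s} \<omega> \<partial>?Q)"
    unfolding first_max_diff_const by (intro nn_integral_cong) (auto split: split_indicator)
  also have "\<dots> = (\<integral>\<^sup>+x. indicator S x \<partial>process_law ?Q ?Z)"
    by (rule law[symmetric]) measurable
  also have "\<dots> = (\<integral>\<^sup>+x. indicator S x \<partial>process_law M (\<lambda>t. Y (t - h)))"
    using tilted_increment_law[OF M G E stat s2, of h] by (simp add: Y_def)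
  also have "\<dots> = (\<integral>\<^sup>+\<omega>. indicator {\<omega>. first_max (\<lambda>m. Y (m - h) \<omega>) s} \<omega> \<partial>M)"
    by (rule law) measurable
  finally show ?thesis .
qed

section \<open>Integration along the paths\<close>

lemma nn_integral_lborel_fold:
  fixes f :: "real \<Rightarrow> ennreal"
  assumes [measurable]: "f \<in> borel_measurable borel"
  shows "(\<integral>\<^sup>+t. f t \<partial>lborel) = (\<integral>\<^sup>+u. (\<integral>\<^sup>+k. f (u + of_int k) \<partial>count_space UNIV) * indicator {0..<1} u \<partial>lborel)"
proof -
  have "f t = (\<integral>\<^sup>+k. f t * indicator {of_int k..<of_int k + 1} t \<partial>count_space (UNIV :: int set))" for t
  proof -
    have *: "indicator {of_int k..<of_int k + 1} t = (indicator {\<lfloor>t\<rfloor>} k :: ennreal)" for k :: int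
    proof -
      have "k = \<lfloor>t\<rfloor> \<longleftrightarrow> of_int k \<le> t \<and> t < of_int k + 1" by (metis floor_eq_iff)
      then show ?thesis by (simp add: indicator_def)
    qed
    show ?thesis
      unfolding * by (subst nn_integral_cmult) auto
  qed
  then have "(\<integral>\<^sup>+t. f t \<partial>lborel)
     = (\<integral>\<^sup>+t. \<integral>\<^sup>+k. f t * indicator {of_int k..<of_int k + 1} t \<partial>count_space (UNIV :: int set) \<partial>lborel)"
    by simp
  also have "\<dots> = (\<integral>\<^sup>+k. \<integral>\<^sup>+t. f t * indicator {of_int k..<of_int k + 1} t \<partial>lborel \<partial>count_space (UNIV :: int set))"
    by (rule nn_integral_count_space_nn_integral) auto
  also have "\<dots> = (\<integral>\<^sup>+k. \<integral>\<^sup>+u. f (u + of_int k) * indicator {0..<1} u \<partial>lborel \<partial>count_space (UNIV :: int set))"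
  proof (rule nn_integral_cong)
    fix k :: int
    show "(\<integral>\<^sup>+t. f t * indicator {of_int k..<of_int k + 1} t \<partial>lborel) = (\<integral>\<^sup>+u. f (u + of_int k) * indicator {0..<1} u \<partial>lborel)"
      by (subst nn_integral_real_affine[where c = 1 and t = "of_int k"])
         (auto intro!: nn_integral_cong simp: add.commute split: split_indicator)
  qed
  also have "\<dots> = (\<integral>\<^sup>+u. \<integral>\<^sup>+k. f (u + of_int k) * indicator {0..<1} u \<partial>count_space (UNIV :: int set) \<partial>lborel)"
    by (rule nn_integral_count_space_nn_integral[symmetric]) auto
  also have "\<dots> = (\<integral>\<^sup>+u. (\<integral>\<^sup>+k. f (u + of_int k) \<partial>count_space UNIV) * indicator {0..<1} u \<partial>lborel)"
    by (simp add: nn_integral_multc)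
  finally show ?thesis .
qed

text \<open>Joint measurability is needed for Fubini. By continuity the process is the limit of its values at
  the grid points \<open>\<lfloor>(n + 1) * t\<rfloor> / (n + 1)\<close>, which depend on \<open>t\<close> through a countable parameter.\<close>

lemma measurable_continuous_process:
  fixes W :: "real \<Rightarrow> 'a \<Rightarrow> real"
  assumes [measurable]: "\<And>t. W t \<in> borel_measurable M"
    and cont: "\<And>\<omega>. \<omega> \<in> space M \<Longrightarrow> continuous_on UNIV (\<lambda>t. W t \<omega>)"
  shows "(\<lambda>(t, \<omega>). W t \<omega>) \<in> borel_measurable (borel \<Otimes>\<^sub>M M)"
proof (rule borel_measurable_LIMSEQ_real)
  fix n :: nat
  let ?r = "\<lambda>k. of_int k / real (Suc n)"
  have "(\<lambda>p. W (?r \<lfloor>real (Suc n) * fst p\<rfloor>) (snd p)) \<in> borel_measurable (borel \<Otimes>\<^sub>M M)"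
    by (rule measurable_compose_countable[where g = "\<lambda>p. \<lfloor>real (Suc n) * fst p\<rfloor>"]) measurable
  then show "(\<lambda>(t, \<omega>). W (?r \<lfloor>real (Suc n) * t\<rfloor>) \<omega>) \<in> borel_measurable (borel \<Otimes>\<^sub>M M)"
    by (simp add: case_prod_beta')
next
  fix p assume p: "p \<in> space ((borel :: real measure) \<Otimes>\<^sub>M M)"
  obtain t \<omega> where [simp]: "p = (t, \<omega>)" by force
  have "(\<lambda>n. of_int \<lfloor>real (Suc n) * t\<rfloor> / real (Suc n)) \<longlonglongrightarrow> t"
  proof (rule real_tendsto_sandwich)
    show "(\<lambda>n. t - 1 / real (Suc n)) \<longlonglongrightarrow> t"
      using tendsto_diff[OF tendsto_const LIMSEQ_inverse_real_of_nat] by (simp add: inverse_eq_divide)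
    show "\<forall>\<^sub>F n in sequentially. t - 1 / real (Suc n) \<le> of_int \<lfloor>real (Suc n) * t\<rfloor> / real (Suc n)"
    proof (intro always_eventually allI)
      fix n
      have "real (Suc n) * t - 1 \<le> of_int \<lfloor>real (Suc n) * t\<rfloor>" by linarith
      then have "(real (Suc n) * t - 1) / real (Suc n) \<le> of_int \<lfloor>real (Suc n) * t\<rfloor> / real (Suc n)"
        by (intro divide_right_mono) auto
      then show "t - 1 / real (Suc n) \<le> of_int \<lfloor>real (Suc n) * t\<rfloor> / real (Suc n)"
        by (simp add: diff_divide_distrib del: of_nat_Suc)
    qed
    show "\<forall>\<^sub>F n in sequentially. of_int \<lfloor>real (Suc n) * t\<rfloor> / real (Suc n) \<le> t"
      by (intro always_eventually allI) (simp add: pos_divide_le_eq mult.commute of_int_floor_le del: of_nat_Suc)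
  qed simp
  moreover have "isCont (\<lambda>t. W t \<omega>) t"
    using cont[of \<omega>] p by (simp add: space_pair_measure continuous_on_eq_continuous_at)
  ultimately show "(\<lambda>n. case p of (t, \<omega>) \<Rightarrow> W (of_int \<lfloor>real (Suc n) * t\<rfloor> / real (Suc n)) \<omega>) \<longlonglongrightarrow> (case p of (t, \<omega>) \<Rightarrow> W t \<omega>)"
    by (simp del: of_nat_Suc) (rule isCont_tendsto_compose)
qed

theorem theorem7p1:
  fixes M :: "'a measure" and W :: "real \<Rightarrow> 'a \<Rightarrow> real" and sigma2 :: "real \<Rightarrow> real"
  assumes "prob_space M"
    and "gaussian_process M W"
    and "\<And>t. prob_space.expectation M (W t) = 0"
    and "stationary_increments M W"
    and "\<And>\<omega>. \<omega> \<in> space M \<Longrightarrow> continuous_on UNIV (\<lambda>t. W t \<omega>)"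
    and "\<And>t. sigma2 t = prob_space.expectation M (\<lambda>\<omega>. (W t \<omega>)\<^sup>2)"
    and "AE \<omega> in M. filterlim (\<lambda>t. W t \<omega> - sigma2 t / 2) at_bot at_infinity"
  shows "AE \<omega> in M. (\<integral>\<^sup>+ t. ennreal (exp (W t \<omega> - sigma2 t / 2)) \<partial>lborel) < \<infinity>"
proof -
  interpret prob_space M by fact
  interpret LM: pair_sigma_finite lborel M
    by (intro pair_sigma_finite.intro sigma_finite_lborel sigma_finite_measure_axioms)
  note hyp = assms(1-4) assms(6)
  define Z where "Z t \<omega> = W t \<omega> - sigma2 t / 2" for t \<omega>
  define Y where "Y t \<omega> = W t \<omega> - W 0 \<omega> - (LINT \<omega>|M. (W t \<omega> - W 0 \<omega>)\<^sup>2) / 2" for t \<omega>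
  have "gaussian_rv M (W t)" for t
    using centered_gaussian_space_span[OF assms(1-3)] in_process_span[of W t]
    by (auto simp: centered_gaussian_space_def)
  then have W[measurable]: "W t \<in> borel_measurable M" for t by (simp add: gaussian_rv_def)
  have [measurable]: "Y t \<in> borel_measurable M" for t unfolding Y_def by measurable
  have "(\<lambda>(t, \<omega>). W t \<omega>) \<in> borel_measurable (borel \<Otimes>\<^sub>M M)"
    by (rule measurable_continuous_process[OF W assms(5)])
  then have Wj[measurable]: "(\<lambda>(t, \<omega>). W t \<omega>) \<in> borel_measurable (lborel \<Otimes>\<^sub>M M)"
    by (simp cong: measurable_cong_sets sets_pair_measure_cong)
  have "sigma2 = (\<lambda>t. LINT \<omega>|M. (W t \<omega>)\<^sup>2)" using assms(6) by auto
  moreover have "(\<lambda>t. LINT \<omega>|M. (W t \<omega>)\<^sup>2) \<in> borel_measurable lborel"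
    by (rule borel_measurable_lebesgue_integral) measurable
  ultimately have s2[measurable]: "sigma2 \<in> borel_measurable borel" by simp
  have Zj[measurable]: "(\<lambda>(t, \<omega>). Z t \<omega>) \<in> borel_measurable (lborel \<Otimes>\<^sub>M M)"
    unfolding Z_def by measurable
  have [measurable]: "Z t \<in> borel_measurable M" for t unfolding Z_def by measurable
  define E where "E s = {\<omega>\<in>space M. first_max (\<lambda>m. Z m \<omega>) s}" for s
  have [measurable]: "E s \<in> sets M" for s unfolding E_def by measurable
  have tilt: "(\<integral>\<^sup>+\<omega>. ennreal (exp (Z t \<omega>)) * indicator (E s) \<omega> \<partial>M) = (\<integral>\<^sup>+\<omega>. indicator {\<omega>. first_max (\<lambda>m. Y (m - t) \<omega>) s} \<omega> \<partial>M)" for t s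
  proof -
    have "(\<integral>\<^sup>+\<omega>. ennreal (exp (Z t \<omega>)) * indicator (E s) \<omega> \<partial>M)
        = (\<integral>\<^sup>+\<omega>. ennreal (exp (W t \<omega> - sigma2 t / 2)) * indicator {\<omega>. first_max (\<lambda>m. W m \<omega> - sigma2 m / 2) s} \<omega> \<partial>M)"
      by (intro nn_integral_cong) (auto simp: Z_def E_def split: split_indicator)
    also have "\<dots> = (\<integral>\<^sup>+\<omega>. indicator {\<omega>. first_max (\<lambda>m. Y (m - t) \<omega>) s} \<omega> \<partial>M)"
      unfolding Y_def by (rule tilted_first_max[OF hyp])
    finally show ?thesis .
  qed
  \<comment> \<open>summed over the translates of \<open>u\<close>, the right-hand sides are probabilities of disjoint events\<close>
  have sum_le: "(\<integral>\<^sup>+k. (\<integral>\<^sup>+\<omega>. ennreal (exp (Z (u + of_int k) \<omega>)) * indicator (E s) \<omega> \<partial>M) \<partial>count_space UNIV) \<le> 1" for u s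
  proof -
    let ?F = "\<lambda>k \<omega>. indicator {\<omega>. first_max (\<lambda>m. Y (of_int m - u) \<omega>) (s - k)} \<omega> :: ennreal"
    have sh: "first_max (\<lambda>m. Y (of_int m - (u + of_int k)) \<omega>) s \<longleftrightarrow> first_max (\<lambda>m. Y (of_int m - u) \<omega>) (s - k)" for k \<omega>
      using first_max_shift[of "\<lambda>m. Y (of_int m - u) \<omega>" k s] by (simp add: algebra_simps)
    have "(\<integral>\<^sup>+k. (\<integral>\<^sup>+\<omega>. ennreal (exp (Z (u + of_int k) \<omega>)) * indicator (E s) \<omega> \<partial>M) \<partial>count_space UNIV)
       = (\<integral>\<^sup>+k. \<integral>\<^sup>+\<omega>. ?F k \<omega> \<partial>M \<partial>count_space UNIV)"
      unfolding tilt sh ..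
    also have "\<dots> = (\<integral>\<^sup>+\<omega>. \<integral>\<^sup>+k. ?F k \<omega> \<partial>count_space UNIV \<partial>M)"
      by (rule nn_integral_count_space_nn_integral[symmetric]) auto
    also have "\<dots> \<le> (\<integral>\<^sup>+\<omega>. 1 \<partial>M)"
      by (intro nn_integral_mono nn_integral_first_max_translates_le_1)
    finally show ?thesis by (simp add: emeasure_space_1)
  qed
  \<comment> \<open>integrating over a period \<open>u \<in> {0..<1}\<close> gives the integral over the whole line\<close>
  have bound: "(\<integral>\<^sup>+\<omega>. (\<integral>\<^sup>+t. exp (Z t \<omega>) \<partial>lborel) * indicator (E s) \<omega> \<partial>M) \<le> 1" for s
  proof -
    have "(\<integral>\<^sup>+\<omega>. (\<integral>\<^sup>+t. exp (Z t \<omega>) \<partial>lborel) * indicator (E s) \<omega> \<partial>M)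
        = (\<integral>\<^sup>+\<omega>. \<integral>\<^sup>+t. ennreal (exp (Z t \<omega>)) * indicator (E s) \<omega> \<partial>lborel \<partial>M)"
      by (intro nn_integral_cong nn_integral_multc[symmetric]) measurable
    also have "\<dots> = (\<integral>\<^sup>+t. \<integral>\<^sup>+\<omega>. ennreal (exp (Z t \<omega>)) * indicator (E s) \<omega> \<partial>M \<partial>lborel)"
      by (rule LM.Fubini') measurable
    also have "\<dots> = (\<integral>\<^sup>+u. (\<integral>\<^sup>+k. (\<integral>\<^sup>+\<omega>. ennreal (exp (Z (u + of_int k) \<omega>)) * indicator (E s) \<omega> \<partial>M) \<partial>count_space UNIV) * indicator {0..<1} u \<partial>lborel)"
    proof (rule nn_integral_lborel_fold)
      have "(\<lambda>t. \<integral>\<^sup>+\<omega>. ennreal (exp (Z t \<omega>)) * indicator (E s) \<omega> \<partial>M) \<in> borel_measurable lborel"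
        by measurable
      then show "(\<lambda>t. \<integral>\<^sup>+\<omega>. ennreal (exp (Z t \<omega>)) * indicator (E s) \<omega> \<partial>M) \<in> borel_measurable borel"
        by simp
    qed
    also have "\<dots> \<le> (\<integral>\<^sup>+u. indicator {0..<1::real} u \<partial>lborel)"
      using sum_le by (intro nn_integral_mono) (auto split: split_indicator)
    finally show ?thesis by simp
  qed
  have "AE \<omega> in M. \<forall>s. (\<integral>\<^sup>+t. exp (Z t \<omega>) \<partial>lborel) * indicator (E s) \<omega> \<noteq> \<infinity>"
    unfolding AE_all_countable
  proof
    fix s
    have "(\<integral>\<^sup>+\<omega>. (\<integral>\<^sup>+t. exp (Z t \<omega>) \<partial>lborel) * indicator (E s) \<omega> \<partial>M) \<noteq> \<infinity>"
      using bound[of s] by (auto simp: top_unique)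
    then show "AE \<omega> in M. (\<integral>\<^sup>+t. exp (Z t \<omega>) \<partial>lborel) * indicator (E s) \<omega> \<noteq> \<infinity>"
      by (intro nn_integral_noteq_infinite) measurable
  qed
  \<comment> \<open>almost every path lies in some \<open>E s\<close>, by the assumed behaviour at infinity\<close>
  with assms(7) AE_space show ?thesis
  proof eventually_elim
    case (elim \<omega>)
    have "\<forall>\<^sub>F t in at_infinity. Z t \<omega> < Z 0 \<omega>"
      using elim(1) unfolding filterlim_at_bot_dense Z_def by auto
    then obtain b where b: "\<And>t. b \<le> \<bar>t\<bar> \<Longrightarrow> Z t \<omega> < Z 0 \<omega>"
      unfolding eventually_at_infinity by auto
    have "{m. Z 0 \<omega> \<le> Z (real_of_int m) \<omega>} \<subseteq> {- \<lceil>b\<rceil>..\<lceil>b\<rceil>}"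
    proof safe
      fix m assume "Z 0 \<omega> \<le> Z (real_of_int m) \<omega>"
      with b[of "real_of_int m"] have "\<bar>real_of_int m\<bar> < b" by (meson not_less not_le)
      then show "m \<in> {- \<lceil>b\<rceil>..\<lceil>b\<rceil>}" by (auto simp: le_ceiling_iff) linarith+
    qed
    then have "finite {m. Z (real_of_int 0) \<omega> \<le> Z (real_of_int m) \<omega>}"
      by (auto intro: finite_subset)
    from first_max_exists[OF this] obtain s where "\<omega> \<in> E s"
      using elim by (auto simp: E_def)
    with elim(3)[rule_format, of s] show ?case
      by (simp add: Z_def less_top)
  qed
qed

end
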